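(* Let $d\ge 2$, let $\rho=|\psi\rangle\langle\psi|$ be a pure state on a $d$-dimensional Hilbert space with robustness $\mathcal{R}_{\mathcal{L}}(\rho)$ with respect to a set of free states $\mathcal{L}$, and let $Y^*=c\,|y\rangle\langle y|$, with $|y\rangle$ a normalized vector, be an optimal robustness witness for $\rho$ with respect to $\mathcal{L}$. Let $\beta>0$ and $\lambda>0$, and let $\tau^\beta_{\lambda Y^*}=e^{-\beta\lambda Y^*}/\mathrm{Tr}(e^{-\beta\lambda Y^*})$ be the thermal state in which the system ends after the optimal work-extraction protocol with Hamiltonian $H=\lambda Y^*$ at inverse temperature $\beta$. Then for every resource theory, with set of free states $\mathcal{L}'$, in which the maximally mixed state is free, $\mathbb{I}/d\in\mathcal{L}'$, $$\mathcal{R}_{\mathcal{L}'}\big(\tau^\beta_{\lambda Y^*}\big)\le\frac{1}{d-1}.$$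
   Context: A state is a positive semidefinite operator of unit trace. The sets of free states $\mathcal{L}$, $\mathcal{L}'$ are nonempty, closed, convex sets of states on the $d$-dimensional Hilbert space. For such a set $\mathcal{L}$, the generalized robustness is $\mathcal{R}_{\mathcal{L}}(\rho):=\min\{s\ge 0 : \text{there is a state }\gamma\text{ with }\frac{\rho+s\gamma}{1+s}\in\mathcal{L}\}$. It has the dual form $\mathcal{R}_{\mathcal{L}}(\rho)=\max\{\mathrm{Tr}(Y\rho)-1 : Y\ge 0,\ \mathrm{Tr}(Y\sigma)\le 1\ \forall\sigma\in\mathcal{L}\}$ ($Y$ Hermitian). An optimal robustness witness for $\rho$ is an operator $Y^*\ge0$ with $\mathrm{Tr}(Y^*\sigma)\le 1$ for all $\sigma\in\mathcal{L}$ and $\mathrm{Tr}(Y^*\rho)-1=\mathcal{R}_{\mathcal{L}}(\rho)$. The work-extraction protocol referred to consists of loading $\rho$ into a system with Hamiltonian $\lambda Y^*$ and letting it thermalize with a bath at inverse temperature $\beta$, extracting the free-energy difference as work; its final state is $\tau^\beta_{\lambda Y^*}$. *)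

theory Defs
  imports "HOL-Analysis.Analysis"
begin

text \<open>Operators on the Hilbert space \<open>complex ^ 'n\<close> of dimension \<open>CARD('n)\<close> are
  matrices \<open>complex ^ 'n ^ 'n\<close>, where \<open>A $ i $ j\<close> is the entry in row \<open>i\<close>, column \<open>j\<close>.
  The type class topology and real vector space structure are entrywise, so \<open>closed\<close> and
  \<open>convex\<close> have their usual meaning for sets of operators.\<close>

definition cinner :: "complex ^ 'n \<Rightarrow> complex ^ 'n \<Rightarrow> complex" where
  "cinner v w = (\<Sum>i\<in>UNIV. cnj (v $ i) * w $ i)"

definition ketbra :: "complex ^ 'n \<Rightarrow> complex ^ 'n \<Rightarrow> complex ^ 'n ^ 'n" where
  "ketbra v w = (\<chi> i j. v $ i * cnj (w $ j))"

definition hermitian :: "complex ^ 'n ^ 'n \<Rightarrow> bool" where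
  "hermitian A \<longleftrightarrow> (\<chi> i j. cnj (A $ j $ i)) = A"

text \<open>For Hermitian \<open>A\<close> the quadratic form is real, so taking the real part loses nothing;
  likewise for the trace of a product of two Hermitian matrices below.\<close>

definition psd :: "complex ^ 'n ^ 'n \<Rightarrow> bool" where
  "psd A \<longleftrightarrow> hermitian A \<and> (\<forall>v. 0 \<le> Re (cinner v (A *v v)))"

definition state :: "complex ^ 'n ^ 'n \<Rightarrow> bool" where
  "state A \<longleftrightarrow> psd A \<and> trace A = 1"

definition free_states :: "(complex ^ 'n ^ 'n) set \<Rightarrow> bool" where
  "free_states L \<longleftrightarrow> L \<noteq> {} \<and> closed L \<and> convex L \<and> (\<forall>\<sigma>\<in>L. state \<sigma>)"

definition robustness_feasible :: "(complex ^ 'n ^ 'n) set \<Rightarrow> complex ^ 'n ^ 'n \<Rightarrow> real set" where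
  "robustness_feasible L \<rho> =
     {s. 0 \<le> s \<and> (\<exists>\<gamma>. state \<gamma> \<and> (1 / (1 + s)) *\<^sub>R (\<rho> + s *\<^sub>R \<gamma>) \<in> L)}"

text \<open>The value is \<open>\<infinity>\<close> if no \<open>s\<close> is feasible (that is, if no free state has a
  support containing that of \<open>\<rho>\<close>); otherwise, for closed \<open>L\<close>, the infimum is a minimum, see
  \<open>robustness_attained\<close>.\<close>

definition robustness :: "(complex ^ 'n ^ 'n) set \<Rightarrow> complex ^ 'n ^ 'n \<Rightarrow> ereal" where
  "robustness L \<rho> = (INF s\<in>robustness_feasible L \<rho>. ereal s)"

definition optimal_witness ::
    "(complex ^ 'n ^ 'n) set \<Rightarrow> complex ^ 'n ^ 'n \<Rightarrow> complex ^ 'n ^ 'n \<Rightarrow> bool" where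
  "optimal_witness L \<rho> Y \<longleftrightarrow>
     psd Y \<and> (\<forall>\<sigma>\<in>L. Re (trace (Y ** \<sigma>)) \<le> 1) \<and>
     ereal (Re (trace (Y ** \<rho>)) - 1) = robustness L \<rho>"

text \<open>The operation \<open>*\<close> on this type is entrywise, so the exponential series is written with
  \<open>**\<close>; its convergence is \<open>sums_mat_exp\<close>.\<close>

definition mat_exp :: "complex ^ 'n ^ 'n \<Rightarrow> complex ^ 'n ^ 'n" where
  "mat_exp A = (\<Sum>k. (1 / fact k) *\<^sub>R (((**) A) ^^ k) (mat 1))"

definition thermal_state :: "real \<Rightarrow> complex ^ 'n ^ 'n \<Rightarrow> complex ^ 'n ^ 'n" where
  "thermal_state \<beta> H =
     (let E = mat_exp ((- \<beta>) *\<^sub>R H) in (\<chi> i j. E $ i $ j / trace E))"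

definition maximally_mixed :: "complex ^ 'n ^ 'n" where
  "maximally_mixed = (1 / real CARD('n)) *\<^sub>R mat 1"

lemma sums_mat_exp:
  fixes A :: "complex ^ 'n ^ 'n"
  shows "(\<lambda>k. (1 / fact k) *\<^sub>R (((**) A) ^^ k) (mat 1)) sums mat_exp A"
proof -
  have "bilinear ((**) :: complex ^ 'n ^ 'n \<Rightarrow> complex ^ 'n ^ 'n \<Rightarrow> complex ^ 'n ^ 'n)"
    unfolding bilinear_def
    by (intro conjI allI linearI)
      (simp_all add: matrix_matrix_mult_def vec_eq_iff distrib_left distrib_right sum.distrib
        scaleR_sum_right)
  then have "\<exists>K>0. \<forall>(B :: complex ^ 'n ^ 'n) (C :: complex ^ 'n ^ 'n). norm (B ** C) \<le> K * norm B * norm C"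
    by (rule bilinear_bounded_pos)
  then obtain K where K: "K > 0"
      "\<forall>(B :: complex ^ 'n ^ 'n) (C :: complex ^ 'n ^ 'n). norm (B ** C) \<le> K * norm B * norm C"
    by (elim exE conjE)
  have bound: "norm ((((**) A) ^^ k) (mat 1)) \<le> (K * norm A) ^ k * norm (mat 1 :: complex ^ 'n ^ 'n)"
    for k
  proof (induction k)
    case (Suc k)
    have "norm ((((**) A) ^^ Suc k) (mat 1)) \<le> K * norm A * norm ((((**) A) ^^ k) (mat 1))"
      using K(2)[rule_format, of A "(((**) A) ^^ k) (mat 1)"] by (simp only: funpow.simps comp_apply)
    also have "\<dots> \<le> K * norm A * ((K * norm A) ^ k * norm (mat 1 :: complex ^ 'n ^ 'n))"
      using K(1) Suc.IH by (intro mult_left_mono) auto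
    finally show ?case by (simp add: mult_ac)
  qed simp
  have "summable (\<lambda>k. inverse (fact k) * (K * norm A) ^ k * norm (mat 1 :: complex ^ 'n ^ 'n))"
    by (intro summable_mult2 summable_exp)
  then have "summable (\<lambda>k. (1 / fact k) *\<^sub>R (((**) A) ^^ k) (mat 1))"
  proof (rule summable_comparison_test')
    fix k :: nat
    have "norm ((1 / fact k) *\<^sub>R (((**) A) ^^ k) (mat 1)) = inverse (fact k) * norm ((((**) A) ^^ k) (mat 1))"
      by (simp add: inverse_eq_divide)
    also have "\<dots> \<le> inverse (fact k) * ((K * norm A) ^ k * norm (mat 1 :: complex ^ 'n ^ 'n))"
      by (intro mult_left_mono bound) simp
    finally show "norm ((1 / fact k) *\<^sub>R (((**) A) ^^ k) (mat 1))
        \<le> inverse (fact k) * (K * norm A) ^ k * norm (mat 1 :: complex ^ 'n ^ 'n)"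
      by (simp only: mult.assoc)
  qed
  then show ?thesis
    unfolding mat_exp_def by (rule summable_sums)
qed

lemma psd_entry_bound:
  assumes "psd A"
  shows "norm (A $ i $ j) \<le> Re (trace A)"
proof -
  have h: "A $ j $ i = cnj (A $ i $ j)" for i j
    using assms by (auto simp: psd_def hermitian_def vec_eq_iff)
  have q: "0 \<le> Re (cinner v (A *v v))" for v
    using assms by (simp add: psd_def)
  have ax: "cinner (axis i 1) (A *v axis i 1) = A $ i $ i" for i
    by (simp add: cinner_def axis_def matrix_vector_mult_def if_distrib if_distribR cong: if_cong)
  have diag: "0 \<le> Re (A $ i $ i)" for i
    using q[of "axis i 1"] by (simp add: ax)
  have tr: "(\<Sum>k\<in>S. Re (A $ k $ k)) \<le> Re (trace A)" for S
    unfolding trace_def Re_sum by (intro sum_mono2) (auto simp: diag)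
  show ?thesis
  proof (cases "i = j")
    case True
    have "Im (A $ i $ i) = 0"
      using h[of i i] by (simp add: complex_eq_iff)
    then have "norm (A $ i $ i) = Re (A $ i $ i)"
      using diag[of i] by (simp add: cmod_def)
    then show ?thesis using tr[of "{i}"] True by simp
  next
    case False
    obtain u where u: "cmod u = 1" "u * A $ i $ j = - of_real (cmod (A $ i $ j))"
    proof (cases "A $ i $ j = 0")
      case True
      then show ?thesis using that[of 1] by simp
    next
      case False
      then show ?thesis
        using that[of "- of_real (cmod (A $ i $ j)) / A $ i $ j"] by (simp add: norm_divide)
    qed
    define v where "v = (\<chi> k. if k = i then 1 else if k = j then u else 0)"
    have uu: "cnj u * u = 1"
      using complex_norm_square[of u] u(1) by (simp add: mult.commute)
    have s: "(\<Sum>k\<in>UNIV. f k * v $ k) = f i + f j * u"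
            "(\<Sum>k\<in>UNIV. cnj (v $ k) * f k) = f i + cnj u * f j" for f :: "'a \<Rightarrow> complex"
    proof -
      have "(\<Sum>k\<in>UNIV. f k * v $ k) = (\<Sum>k\<in>{i,j}. f k * v $ k)"
        by (intro sum.mono_neutral_right) (auto simp: v_def)
      then show "(\<Sum>k\<in>UNIV. f k * v $ k) = f i + f j * u"
        using False by (simp add: v_def)
      have "(\<Sum>k\<in>UNIV. cnj (v $ k) * f k) = (\<Sum>k\<in>{i,j}. cnj (v $ k) * f k)"
        by (intro sum.mono_neutral_right) (auto simp: v_def)
      then show "(\<Sum>k\<in>UNIV. cnj (v $ k) * f k) = f i + cnj u * f j"
        using False by (simp add: v_def)
    qed
    have "cinner v (A *v v) = A$i$i + A$i$j * u + cnj u * (A$j$i + A$j$j * u)"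
      by (simp add: cinner_def matrix_vector_mult_def s)
    also have "\<dots> = A$i$i + u * A$i$j + cnj (u * A$i$j) + A$j$j"
      using uu by (simp add: h[of j i] algebra_simps)
    finally have "Re (cinner v (A *v v)) = Re (A$i$i) + Re (A$j$j) - 2 * cmod (A$i$j)"
      unfolding u(2) by simp
    then have "2 * cmod (A$i$j) \<le> Re (trace A)"
      using q[of v] tr[of "{i,j}"] False by simp
    then show ?thesis
      using norm_ge_zero[of "A$i$j"] by linarith
  qed
qed

lemma closed_psd: "closed {A. psd A}"
proof -
  have "{A. psd A} = {A. (\<chi> i j. cnj (A $ j $ i)) = A} \<inter> (\<Inter>v. {A. 0 \<le> Re (cinner v (A *v v))})"
    by (auto simp: psd_def hermitian_def)
  also have "closed \<dots>"
    unfolding cinner_def matrix_vector_mult_def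
    by (intro closed_Int closed_INT ballI closed_Collect_eq closed_Collect_le continuous_intros)
  finally show ?thesis .
qed

lemma compact_states: "compact {A. state A}"
proof -
  have "closed ({A. psd A} \<inter> {A. trace A = 1})"
    unfolding trace_def
    by (intro closed_Int closed_psd closed_Collect_eq continuous_intros)
  moreover have "{A. psd A} \<inter> {A. trace A = 1} = {A. state A}"
    by (auto simp: state_def)
  moreover have "norm A \<le> (\<Sum>i\<in>(UNIV :: 'n set). \<Sum>j\<in>(UNIV :: 'n set). 1)"
    if "state A" for A :: "complex ^ 'n ^ 'n"
  proof -
    have e: "norm (A $ i $ j) \<le> 1" for i j
      using psd_entry_bound[of A i j] that by (simp add: state_def)
    have "norm A \<le> (\<Sum>i\<in>UNIV. norm (A $ i))"
      unfolding norm_vec_def by (rule L2_set_le_sum) auto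
    also have "\<dots> \<le> (\<Sum>i\<in>UNIV. \<Sum>j\<in>UNIV. norm (A $ i $ j))"
      by (intro sum_mono) (auto simp: norm_vec_def intro: L2_set_le_sum)
    also have "\<dots> \<le> (\<Sum>i\<in>(UNIV :: 'n set). \<Sum>j\<in>(UNIV :: 'n set). 1)"
      using e by (intro sum_mono)
    finally show ?thesis .
  qed
  ultimately show ?thesis
    by (metis (mono_tags, lifting) boundedI compact_eq_bounded_closed mem_Collect_eq)
qed

lemma robustness_attained:
  fixes L :: "(complex ^ 'n ^ 'n) set"
  assumes "closed L" and "robustness_feasible L \<rho> \<noteq> {}"
  shows "\<exists>s\<in>robustness_feasible L \<rho>. robustness L \<rho> = ereal s"
proof -
  obtain s0 where s0: "s0 \<in> robustness_feasible L \<rho>" using assms(2) by auto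
  define K where "K = ({0..s0} \<times> {\<gamma>. state \<gamma>}) \<inter>
    (\<lambda>p. (1 / (1 + fst p)) *\<^sub>R (\<rho> + fst p *\<^sub>R snd p)) -` L"
  have comp: "compact ({0..s0} \<times> {\<gamma> :: complex ^ 'n ^ 'n. state \<gamma>})"
    by (intro compact_Times compact_Icc compact_states)
  have Kmem: "(s, \<gamma>) \<in> K \<longleftrightarrow> 0 \<le> s \<and> s \<le> s0 \<and> state \<gamma> \<and>
      (1 / (1 + s)) *\<^sub>R (\<rho> + s *\<^sub>R \<gamma>) \<in> L" for s \<gamma>
    by (simp add: K_def)
  have "closed K"
    unfolding K_def
    by (intro continuous_closed_preimage continuous_intros compact_imp_closed comp assms(1)) auto
  moreover have "K \<subseteq> {0..s0} \<times> {\<gamma>. state \<gamma>}"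
    by (simp add: K_def)
  ultimately have "compact K"
    using compact_Int_closed[OF comp, of K] by (simp add: Int_absorb1)
  moreover have ne: "K \<noteq> {}"
  proof -
    from s0 obtain \<gamma> where "(s0, \<gamma>) \<in> K"
      unfolding robustness_feasible_def Kmem by blast
    then show ?thesis by blast
  qed
  ultimately obtain p where p: "p \<in> K" "\<forall>q\<in>K. fst p \<le> fst q"
    using continuous_attains_inf[OF _ _ continuous_on_fst[OF continuous_on_id]] by blast
  obtain t \<gamma>0 where t: "p = (t, \<gamma>0)" by fastforce
  have pf: "t \<in> robustness_feasible L \<rho>" and "t \<le> s0"
    using p(1) unfolding t Kmem robustness_feasible_def by blast+
  have le: "t \<le> s" if s: "s \<in> robustness_feasible L \<rho>" for s
  proof (cases "s \<le> s0")
    case True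
    with s obtain \<gamma> where "(s, \<gamma>) \<in> K"
      unfolding robustness_feasible_def Kmem by blast
    with p(2) t show ?thesis by fastforce
  next
    case False
    then show ?thesis using \<open>t \<le> s0\<close> by simp
  qed
  have "robustness L \<rho> \<le> ereal t"
    unfolding robustness_def using pf by (rule INF_lower)
  moreover have "ereal t \<le> robustness L \<rho>"
    unfolding robustness_def by (rule INF_greatest) (simp add: le)
  ultimately have "robustness L \<rho> = ereal t"
    by (rule antisym)
  then show ?thesis using pf by blast
qed

end

theory Submission imports Defs begin

text \<open>Write \<open>d\<close> for the dimension, \<open>P = |y\<rangle>\<langle>y|\<close> and \<open>q = exp (- \<beta> \<lambda> c)\<close>; positivity of
  the witness gives \<open>c \<ge> 0\<close>, hence \<open>q \<le> 1\<close>. As \<open>P\<close> is a projection, the thermal state is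
  \<open>\<tau> = (I - (1 - q) P) / (d - 1 + q)\<close>. With \<open>s = 1 / (d - 1)\<close>, the operator
  \<open>\<gamma> = I - (d - 1) \<tau> = (q I + (d - 1) (1 - q) P) / (d - 1 + q)\<close> is a state and
  \<open>(\<tau> + s \<gamma>) / (1 + s) = I / d\<close> is free, so \<open>s\<close> is feasible.\<close>

text \<open>Every power of \<open>a *\<^sub>R P\<close> beyond the zeroth is a multiple of
  \<open>P\<close> by idempotence, so the exponential series is the scalar series for
  \<open>exp a\<close> times \<open>P\<close>, except in its constant term.\<close>

lemma mat_exp_idempotent:
  fixes P :: "complex ^ 'n ^ 'n"
  assumes "P ** P = P"
  shows "mat_exp (a *\<^sub>R P) = mat 1 + (exp a - 1) *\<^sub>R P"
proof -
  have mult: "(a *\<^sub>R P) ** (b *\<^sub>R P) = (a * b) *\<^sub>R P" for b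
  proof -
    have "(a *\<^sub>R P) ** (b *\<^sub>R P) = (a * b) *\<^sub>R (P ** P)"
      by (simp add: matrix_matrix_mult_def vec_eq_iff scaleR_sum_right mult.commute[of b a])
    then show ?thesis using assms by simp
  qed
  have pow: "(((**) (a *\<^sub>R P)) ^^ Suc k) (mat 1) = a ^ Suc k *\<^sub>R P" for k
    by (induction k) (simp_all add: mult)
  \<comment> \<open>At \<open>k = 0\<close> the term is \<open>mat 1\<close>, where the scalar
    series would give \<open>P\<close>; the conditional supplies the difference.\<close>
  have summand: "(1 / fact k) *\<^sub>R (((**) (a *\<^sub>R P)) ^^ k) (mat 1) =
      (a ^ k /\<^sub>R fact k) *\<^sub>R P + (if k = 0 then mat 1 - P else 0)" for k
  proof (cases k)
    case (Suc m)
    show ?thesis unfolding Suc pow by (simp add: divide_inverse mult_ac)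
  qed simp
  have "(\<lambda>k. (a ^ k /\<^sub>R fact k) *\<^sub>R P + (if k = 0 then mat 1 - P else 0)) sums
      (exp a *\<^sub>R P + (mat 1 - P))"
    by (intro sums_add sums_scaleR_left exp_converges sums_single[of 0 "\<lambda>_. mat 1 - P"])
  then have "mat_exp (a *\<^sub>R P) = exp a *\<^sub>R P + (mat 1 - P)"
    using sums_mat_exp[of "a *\<^sub>R P"] sums_unique2 unfolding summand by blast
  then show ?thesis by (simp add: algebra_simps)
qed

lemma sum_mult_cnj_eq_norm_sq:
  fixes v :: "complex ^ 'n"
  shows "(\<Sum>i\<in>UNIV. v $ i * cnj (v $ i)) = of_real ((norm v)\<^sup>2)"
  by (simp add: norm_vec_def L2_set_def sum_nonneg flip: complex_norm_square)

lemma ketbra_mult_ketbra: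
  "ketbra u v ** ketbra v w = (norm v)\<^sup>2 *\<^sub>R ketbra u w"
proof -
  have "(\<Sum>k\<in>UNIV. u $ i * cnj (v $ k) * (v $ k * cnj (w $ j))) =
      (\<Sum>k\<in>UNIV. v $ k * cnj (v $ k)) * (u $ i * cnj (w $ j))" for i j
    unfolding sum_distrib_right by (simp add: mult_ac)
  then show ?thesis
    by (simp add: ketbra_def matrix_matrix_mult_def vec_eq_iff sum_mult_cnj_eq_norm_sq
        scaleR_conv_of_real[where 'a = complex])
qed

lemma trace_ketbra: "trace (ketbra v v) = of_real ((norm v)\<^sup>2)"
  by (simp add: trace_def ketbra_def sum_mult_cnj_eq_norm_sq)

text \<open>The quadratic form at \<open>w\<close> is the squared modulus of the overlap
  \<open>cinner v w\<close>.\<close>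

lemma psd_ketbra: "psd (ketbra v v)"
proof -
  have mult_v: "ketbra v v *v w = (\<chi> i. v $ i * cinner v w)" for w
    by (simp add: cinner_def ketbra_def matrix_vector_mult_def vec_eq_iff sum_distrib_left mult.assoc)
  have "cinner w (ketbra v v *v w) = of_real ((cmod (cinner v w))\<^sup>2)" for w
  proof -
    have "cinner w (ketbra v v *v w) = (\<Sum>i\<in>UNIV. cnj (w $ i) * v $ i) * cinner v w"
      unfolding sum_distrib_right by (simp add: mult_v cinner_def[of w] mult.assoc)
    also have "(\<Sum>i\<in>UNIV. cnj (w $ i) * v $ i) = cnj (cinner v w)"
      by (simp add: cinner_def mult.commute)
    also have "cnj (cinner v w) * cinner v w = of_real ((cmod (cinner v w))\<^sup>2)"
      using complex_norm_square[of "cinner v w"] by (simp add: mult.commute)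
    finally show ?thesis .
  qed
  then show ?thesis
    by (simp add: psd_def hermitian_def ketbra_def vec_eq_iff mult.commute)
qed

lemma psd_mat_1: "psd (mat 1 :: complex ^ 'n ^ 'n)"
  by (auto simp: psd_def hermitian_def mat_def[of 1] vec_eq_iff)
    \<comment> \<open>Hermiticity was checked entrywise; folding \<open>mat\<close> back lets the
      identity act on the vector, and the quadratic form becomes a sum of squared moduli.\<close>
    (auto simp: cinner_def simp flip: mat_def intro!: sum_nonneg)

lemma psd_add: "psd A \<Longrightarrow> psd B \<Longrightarrow> psd (A + B)"
  by (simp add: psd_def hermitian_def vec_eq_iff cinner_def matrix_vector_mult_def
      distrib_left distrib_right sum.distrib)

lemma psd_scaleR:
  assumes "0 \<le> r" "psd A"
  shows "psd (r *\<^sub>R A)"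
proof -
  have "cinner v ((r *\<^sub>R A) *v v) = r *\<^sub>R cinner v (A *v v)" for v
    by (simp add: cinner_def matrix_vector_mult_def scaleR_sum_right sum_distrib_left)
  then show ?thesis
    using assms by (simp add: psd_def hermitian_def vec_eq_iff)
qed

lemma trace_scaleR: "trace (r *\<^sub>R A) = r *\<^sub>R trace A" for A :: "complex ^ 'n ^ 'n"
  by (simp add: trace_def scaleR_sum_right)

theorem theorem2:
  fixes L L' :: "(complex ^ 'n ^ 'n) set"
    and \<rho> Y :: "complex ^ 'n ^ 'n"
    and \<psi> y :: "complex ^ 'n"
    and c \<beta> lam :: real
  assumes "CARD('n) \<ge> 2"
    and "free_states L"
    and "norm \<psi> = 1" and "\<rho> = ketbra \<psi> \<psi>"
    and "norm y = 1" and "Y = c *\<^sub>R ketbra y y"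
    and "optimal_witness L \<rho> Y"
    and "\<beta> > 0" and "lam > 0"
    and "free_states L'" and "maximally_mixed \<in> L'"
  shows "robustness L' (thermal_state \<beta> (lam *\<^sub>R Y)) \<le> ereal (1 / (real CARD('n) - 1))"
proof -
  define d where "d = real CARD('n)"
  define q where "q = exp (- (\<beta> * lam * c))"
  define P where "P = ketbra y y"
  have d: "d \<ge> 2"
    using assms(1) by (simp add: d_def)
  have P: "psd P" "P ** P = P" "trace P = 1"
    using assms(5) by (simp_all add: P_def psd_ketbra ketbra_mult_ketbra trace_ketbra)
  have tr1: "trace (mat 1 :: complex ^ 'n ^ 'n) = of_real d"
    by (simp add: trace_def mat_def d_def)
  have "psd Y"
    using assms(7) by (simp add: optimal_witness_def)
  \<comment> \<open>The trace dominates the norm of any entry, hence is nonnegative; as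
    \<open>P\<close> has trace 1, the trace of \<open>Y\<close> is \<open>c\<close>.\<close>
  then have "0 \<le> Re (trace Y)"
    using psd_entry_bound norm_ge_zero order_trans by blast
  then have "0 \<le> c"
    using P(3) by (simp add: assms(6) trace_scaleR flip: P_def)
  then have q: "0 < q" "q \<le> 1"
    using assms(8,9) by (simp_all add: q_def)
  define D where "D = d - 1 + q"
  have D: "D > 0"
    using d q by (simp add: D_def)
  define E where "E = mat 1 + (q - 1) *\<^sub>R P"
  have "mat_exp ((- \<beta>) *\<^sub>R (lam *\<^sub>R Y)) = E"
    using mat_exp_idempotent[OF P(2), of "- (\<beta> * lam * c)"]
    by (simp add: assms(6) E_def q_def mult.assoc flip: P_def)
  \<comment> \<open>The trace is real, so the entrywise complex division in
    \<open>thermal_state\<close> is a real scaling by \<open>1 / D\<close>.\<close>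
  moreover have "trace E = of_real D"
    by (simp add: E_def trace_add trace_scaleR tr1 P(3) D_def scaleR_conv_of_real[where 'a = complex])
  ultimately have \<tau>: "thermal_state \<beta> (lam *\<^sub>R Y) = (1 / D) *\<^sub>R E"
    by (simp only: thermal_state_def Let_def) (simp add: vec_eq_iff scaleR_conv_of_real[where 'a = complex])
  define s where "s = 1 / (d - 1)"
  define \<gamma> where "\<gamma> = (1 / D) *\<^sub>R (q *\<^sub>R mat 1 + ((d - 1) * (1 - q)) *\<^sub>R P)"
  have "psd \<gamma>"
    \<comment> \<open>This is where \<open>q \<le> 1\<close>, that is \<open>c \<ge> 0\<close>,
      enters: it makes the weight of \<open>P\<close> nonnegative.\<close>
    unfolding \<gamma>_def using d q D by (intro psd_scaleR psd_add psd_mat_1 P(1)) auto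
  moreover have "trace \<gamma> = 1"
  proof -
    have "trace \<gamma> = of_real ((q * d + (d - 1) * (1 - q)) / D)"
      by (simp add: \<gamma>_def trace_add trace_scaleR tr1 P(3) scaleR_conv_of_real[where 'a = complex])
    also have "q * d + (d - 1) * (1 - q) = D"
      by (simp add: D_def algebra_simps)
    finally show ?thesis using D by simp
  qed
  ultimately have "state \<gamma>"
    by (simp add: state_def)
  moreover have "(1 / (1 + s)) *\<^sub>R ((1 / D) *\<^sub>R E + s *\<^sub>R \<gamma>) \<in> L'"
  proof -
    have "(1 / D) *\<^sub>R E + s *\<^sub>R \<gamma> = (1 / D) *\<^sub>R (E + s *\<^sub>R (q *\<^sub>R mat 1 + ((d - 1) * (1 - q)) *\<^sub>R P))"
      by (simp add: \<gamma>_def scaleR_add_right mult.commute)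
    also have "E + s *\<^sub>R (q *\<^sub>R mat 1 + ((d - 1) * (1 - q)) *\<^sub>R P) =
        (1 + s * q) *\<^sub>R mat 1 + (q - 1 + s * (d - 1) * (1 - q)) *\<^sub>R P"
      by (simp add: E_def scaleR_add_left scaleR_add_right mult.assoc)
    \<comment> \<open>Since \<open>s * (d - 1) = 1\<close>, the \<open>P\<close> parts of
      \<open>E\<close> and of the admixture cancel, leaving a multiple of the identity.\<close>
    also have "q - 1 + s * (d - 1) * (1 - q) = 0"
      using d by (simp add: s_def)
    also have "1 + s * q = s * D"
      using d by (simp add: s_def D_def field_simps)
    finally have "(1 / D) *\<^sub>R E + s *\<^sub>R \<gamma> = s *\<^sub>R mat 1"
      using D by simp
    moreover have "s / (1 + s) = 1 / d"
      using d by (simp add: s_def field_simps)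
    ultimately have "(1 / (1 + s)) *\<^sub>R ((1 / D) *\<^sub>R E + s *\<^sub>R \<gamma>) = maximally_mixed"
      by (simp add: maximally_mixed_def d_def)
    then show ?thesis using assms(11) by simp
  qed
  moreover have "0 \<le> s"
    using d by (simp add: s_def)
  ultimately have "s \<in> robustness_feasible L' (thermal_state \<beta> (lam *\<^sub>R Y))"
    unfolding robustness_feasible_def \<tau> by blast
  \<comment> \<open>The robustness is an infimum, so any feasible value bounds it from
    above.\<close>
  then have "robustness L' (thermal_state \<beta> (lam *\<^sub>R Y)) \<le> ereal s"
    unfolding robustness_def by (rule INF_lower)
  then show ?thesis
    by (simp add: s_def d_def)
qed

end
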